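(* Let $F$ be any field and let $n\geq 1$ be an integer. Let $\mathfrak{h}(n)$ be the Heisenberg algebra of dimension $2n+1$ over $F$ and let $d(n)$ be the minimum dimension of a faithful $\mathfrak{h}(n)$-module. Then $d(n)=n+2$, except only that $d(1)=2$ when $\mathrm{char}(F)=2$.
   Context: For $n\ge 1$, the Heisenberg algebra $\mathfrak{h}(n)=\mathfrak{h}(n,F)$ is the Lie algebra over $F$ with basis $x_1,\dots,x_n,y_1,\dots,y_n,z$ and brackets $[x_i,y_i]=z$ for $1\le i\le n$, all other brackets between basis elements (apart from $[y_i,x_i]=-z$) being zero. Modules are finite dimensional over $F$. A module is faithful if the corresponding Lie algebra homomorphism $\mathfrak{h}(n)\to\mathfrak{gl}(V)$ is injective. *)

theory Defs
  imports Complex_Main "HOL-Library.Function_Algebras" "HOL-Library.FuncSet"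
    "HOL-Computational_Algebra.Computational_Algebra"
begin

section \<open>Lie algebras\<close>

text \<open>Lie algebras and modules are carried by subspaces of an ambient vector space, so that
  their dimension may depend on a natural number.\<close>

locale lie_algebra = vector_space scale
  for scale :: "'a::field \<Rightarrow> 'b::ab_group_add \<Rightarrow> 'b" (infixr \<open>*s\<close> 75) +
  fixes L :: "'b set" and br :: "'b \<Rightarrow> 'b \<Rightarrow> 'b"
  assumes subspace_L: "subspace L"
    and br_closed: "\<lbrakk>x \<in> L; y \<in> L\<rbrakk> \<Longrightarrow> br x y \<in> L"
    and br_add_left: "\<lbrakk>x \<in> L; y \<in> L; w \<in> L\<rbrakk> \<Longrightarrow> br (x + y) w = br x w + br y w"
    and br_add_right: "\<lbrakk>x \<in> L; y \<in> L; w \<in> L\<rbrakk> \<Longrightarrow> br w (x + y) = br w x + br w y"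
    and br_scale_left: "\<lbrakk>x \<in> L; y \<in> L\<rbrakk> \<Longrightarrow> br (c *s x) y = c *s br x y"
    and br_scale_right: "\<lbrakk>x \<in> L; y \<in> L\<rbrakk> \<Longrightarrow> br x (c *s y) = c *s br x y"
    and br_self: "x \<in> L \<Longrightarrow> br x x = 0"
    and jacobi: "\<lbrakk>x \<in> L; y \<in> L; w \<in> L\<rbrakk> \<Longrightarrow> br x (br y w) + br y (br w x) + br w (br x y) = 0"

locale lie_hom =
  dom: lie_algebra sL L brL + cod: lie_algebra sM M brM
  for sL :: "'a::field \<Rightarrow> 'b::ab_group_add \<Rightarrow> 'b" and L brL
    and sM :: "'a \<Rightarrow> 'c::ab_group_add \<Rightarrow> 'c" and M brM +
  fixes \<phi> :: "'b \<Rightarrow> 'c"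
  assumes maps_to: "x \<in> L \<Longrightarrow> \<phi> x \<in> M"
    and map_add: "\<lbrakk>x \<in> L; y \<in> L\<rbrakk> \<Longrightarrow> \<phi> (x + y) = \<phi> x + \<phi> y"
    and map_scale: "x \<in> L \<Longrightarrow> \<phi> (sL c x) = sM c (\<phi> x)"
    and map_br: "\<lbrakk>x \<in> L; y \<in> L\<rbrakk> \<Longrightarrow> \<phi> (brL x y) = brM (\<phi> x) (\<phi> y)"

definition pointwise :: "('a \<Rightarrow> 'b \<Rightarrow> 'b) \<Rightarrow> 'a \<Rightarrow> ('i \<Rightarrow> 'b) \<Rightarrow> 'i \<Rightarrow> 'b"
  where "pointwise s c f = (\<lambda>i. s c (f i))"

lemma vector_space_pointwise:
  assumes "vector_space s" shows "vector_space (pointwise s)"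
proof -
  interpret vector_space s by fact
  show ?thesis
    by unfold_locales (auto simp: pointwise_def fun_eq_iff algebra_simps)
qed

lemma vector_space_coords:
  "vector_space (pointwise (*) :: 'a::field \<Rightarrow> ('i \<Rightarrow> 'a) \<Rightarrow> 'i \<Rightarrow> 'a)"
  by (rule vector_space_pointwise) (unfold_locales, auto simp: algebra_simps)

text \<open>An endomorphism of \<open>V\<close> is represented by the function on the ambient type that
  extends it by \<open>0\<close> outside \<open>V\<close>. Equality of functions is then equality of
  endomorphisms, and sums, multiples and commutators may be formed in the ambient type.\<close>

definition gl :: "('a::field \<Rightarrow> 'v::ab_group_add \<Rightarrow> 'v) \<Rightarrow> 'v set \<Rightarrow> ('v \<Rightarrow> 'v) set"
  where "gl scale V = {f. f \<in> V \<rightarrow> V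
    \<and> (\<forall>u\<in>V. \<forall>v\<in>V. f (u + v) = f u + f v)
    \<and> (\<forall>c. \<forall>v\<in>V. f (scale c v) = scale c (f v))
    \<and> (\<forall>v. v \<notin> V \<longrightarrow> f v = 0)}"

definition commutator :: "('v \<Rightarrow> 'v) \<Rightarrow> ('v \<Rightarrow> 'v) \<Rightarrow> 'v \<Rightarrow> 'v::ab_group_add"
  where "commutator f g = (f \<circ> g) - (g \<circ> f)"

lemma lie_algebra_gl:
  assumes "vector_space scale" and V: "module.subspace scale V"
  shows "lie_algebra (pointwise scale) (gl scale V) commutator"
proof -
  interpret v: vector_space scale by fact
  interpret e: vector_space "pointwise scale" by (rule vector_space_pointwise) fact
  note sub = v.subspace_0[OF V] v.subspace_add[OF V] v.subspace_scale[OF V] v.subspace_diff[OF V]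
  have zero: "f 0 = 0" if "f \<in> gl scale V" for f
  proof -
    have "f (scale 0 0) = scale 0 (f 0)"
      using that sub(1) unfolding gl_def by blast
    then show ?thesis by simp
  qed
  have diff: "f (u - v) = f u - f v" if "f \<in> gl scale V" "u \<in> V" "v \<in> V" for f u v
  proof -
    have "f ((u - v) + v) = f (u - v) + f v"
      using that sub(4)[of u v] unfolding gl_def by blast
    then show ?thesis by (simp add: algebra_simps)
  qed
  have V_all: "f v \<in> V" if "f \<in> gl scale V" for f v
    using that sub(1) unfolding gl_def by (cases "v \<in> V") auto
  have out: "f v = 0" if "f \<in> gl scale V" "v \<notin> V" for f v
    using that unfolding gl_def by auto
  have add: "f (u + v) = f u + f v" if "f \<in> gl scale V" "u \<in> V" "v \<in> V" for f u v
    using that unfolding gl_def by auto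
  have scl: "f (scale c v) = scale c (f v)" if "f \<in> gl scale V" "v \<in> V" for f c v
    using that unfolding gl_def by auto
  have closed: "commutator f g \<in> gl scale V" if f: "f \<in> gl scale V" and g: "g \<in> gl scale V" for f g
    using sub by (auto simp: gl_def commutator_def V_all[OF f] V_all[OF g] add[OF f] add[OF g]
        scl[OF f] scl[OF g] zero[OF f] zero[OF g] out[OF f] out[OF g] algebra_simps v.scale_right_diff_distrib)
  show ?thesis
  proof unfold_locales
    show "e.subspace (gl scale V)"
      unfolding e.subspace_def using sub
      by (auto simp: gl_def pointwise_def Pi_iff v.scale_right_distrib v.scale_left_commute algebra_simps)
    show "commutator f (pointwise scale c g) = pointwise scale c (commutator f g)"
      if "f \<in> gl scale V" "g \<in> gl scale V" for c f g
      by (simp add: fun_eq_iff commutator_def pointwise_def scl[OF that(1)] scl[OF that(2)]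
          V_all[OF that(1)] V_all[OF that(2)] v.scale_right_diff_distrib)
    show "commutator (pointwise scale c f) g = pointwise scale c (commutator f g)"
      if "f \<in> gl scale V" "g \<in> gl scale V" for c f g
      by (simp add: fun_eq_iff commutator_def pointwise_def scl[OF that(1)] scl[OF that(2)]
          V_all[OF that(1)] V_all[OF that(2)] v.scale_right_diff_distrib)
    show "commutator f (commutator g h) + commutator g (commutator h f) + commutator h (commutator f g) = 0"
      if "f \<in> gl scale V" "g \<in> gl scale V" "h \<in> gl scale V" for f g h
      using that by (auto simp: fun_eq_iff commutator_def diff V_all)
    show "commutator f g \<in> gl scale V" if "f \<in> gl scale V" "g \<in> gl scale V" for f g
      using that by (rule closed)
  qed (auto simp: fun_eq_iff commutator_def add V_all)
qed

text \<open>A finite dimensional module is a subspace \<open>V\<close> together with a representation in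
  \<open>gl V\<close>. The dimension \<open>vector_space.dim scale V\<close> alone would not express finiteness, since
  the library sets it to \<open>0\<close> in the infinite dimensional case.\<close>

locale lie_module =
  vector_space scale + rep: lie_hom sL L brL "pointwise scale" "gl scale V" commutator \<rho>
  for sL :: "'a::field \<Rightarrow> 'b::ab_group_add \<Rightarrow> 'b" and L brL
    and scale :: "'a \<Rightarrow> 'v::ab_group_add \<Rightarrow> 'v" and V \<rho> +
  assumes subspace_V: "subspace V"
    and finite_dim: "\<exists>B. finite B \<and> span B = V"

locale faithful_lie_module = lie_module +
  assumes faithful: "inj_on \<rho> L"


section \<open>The Heisenberg algebra\<close>

text \<open>Elements are coordinate vectors with respect to the basis \<open>x\<^sub>i, y\<^sub>i, z\<close>; the index \<open>i\<close>
  runs over \<open>0, \<dots>, n - 1\<close>.\<close>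

datatype heis_index = X nat | Y nat | Z

definition heis_indices :: "nat \<Rightarrow> heis_index set"
  where "heis_indices n = X ` {..<n} \<union> Y ` {..<n} \<union> {Z}"

definition heis :: "nat \<Rightarrow> (heis_index \<Rightarrow> 'a::field) set"
  where "heis n = {f. \<forall>k. k \<notin> heis_indices n \<longrightarrow> f k = 0}"

definition heis_br ::
    "nat \<Rightarrow> (heis_index \<Rightarrow> 'a::field) \<Rightarrow> (heis_index \<Rightarrow> 'a) \<Rightarrow> heis_index \<Rightarrow> 'a"
  where "heis_br n f g =
    (\<lambda>k. if k = Z then (\<Sum>i<n. f (X i) * g (Y i) - f (Y i) * g (X i)) else 0)"

definition unit_vec :: "'i \<Rightarrow> 'i \<Rightarrow> 'a::field"
  where "unit_vec k = (\<lambda>j. if j = k then 1 else 0)"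

lemma lie_algebra_heis: "lie_algebra (pointwise (*)) (heis n) (heis_br n)"
proof -
  interpret vector_space "pointwise (*) :: 'a \<Rightarrow> (heis_index \<Rightarrow> 'a) \<Rightarrow> heis_index \<Rightarrow> 'a"
    by (rule vector_space_coords)
  show ?thesis
    by unfold_locales
      (auto simp: subspace_def heis_def heis_br_def heis_indices_def pointwise_def fun_eq_iff
        sum.distrib sum_subtractf sum_distrib_left algebra_simps)
qed

lemma heis_brackets:
  fixes i j n :: nat and f :: "heis_index \<Rightarrow> 'a::field"
  defines "e \<equiv> unit_vec :: heis_index \<Rightarrow> heis_index \<Rightarrow> 'a"
  assumes "i < n" "j < n"
  shows "heis_br n (e (X i)) (e (Y j)) = (if i = j then e Z else 0)"
    and "heis_br n (e (Y j)) (e (X i)) = (if i = j then - e Z else 0)"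
    and "heis_br n (e (X i)) (e (X j)) = 0"
    and "heis_br n (e (Y i)) (e (Y j)) = 0"
    and "heis_br n (e Z) f = 0" and "heis_br n f (e Z) = 0"
proof -
  have if_mult: "(if P then 1 else 0) * c = (if P then c else 0)" for P and c :: 'a
    by simp
  show "heis_br n (e (X i)) (e (Y j)) = (if i = j then e Z else 0)"
    "heis_br n (e (Y j)) (e (X i)) = (if i = j then - e Z else 0)"
    "heis_br n (e (X i)) (e (X j)) = 0"
    "heis_br n (e (Y i)) (e (Y j)) = 0"
    "heis_br n (e Z) f = 0" "heis_br n f (e Z) = 0"
    using assms by (auto simp: heis_br_def unit_vec_def fun_eq_iff if_mult sum_negf)
qed

lemma heis_basis:
  fixes n :: nat
  defines "B \<equiv> (unit_vec ` heis_indices n :: (heis_index \<Rightarrow> 'a::field) set)"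
  shows "\<not> module.dependent (pointwise (*)) B" "module.span (pointwise (*)) B = heis n"
    "card B = 2 * n + 1"
proof -
  interpret vector_space "pointwise (*) :: 'a \<Rightarrow> (heis_index \<Rightarrow> 'a) \<Rightarrow> heis_index \<Rightarrow> 'a"
    by (rule vector_space_coords)
  have fin: "finite (heis_indices n)" by (simp add: heis_indices_def)
  have inj: "inj_on (unit_vec :: _ \<Rightarrow> heis_index \<Rightarrow> 'a) A" for A
    by (rule inj_onI) (metis unit_vec_def zero_neq_one)
  have sum_apply: "(\<Sum>b\<in>A. F b) k = (\<Sum>b\<in>A. F b k)"
    for F :: "heis_index \<Rightarrow> heis_index \<Rightarrow> 'a" and A k
    by (induction A rule: infinite_finite_induct) auto
  have comb: "(\<Sum>b\<in>B. pointwise (*) (u b) b) k =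
      (if k \<in> heis_indices n then u (unit_vec k) else 0)" for u k
    unfolding B_def by (subst sum.reindex[OF inj])
      (auto simp: sum_apply pointwise_def unit_vec_def fin if_distrib cong: if_cong)
  show "\<not> dependent B"
  proof
    assume "dependent B"
    then obtain u v where u: "v \<in> B" "u v \<noteq> 0" "(\<Sum>b\<in>B. pointwise (*) (u b) b) = 0"
      using dependent_finite[of B] fin unfolding B_def by auto
    then obtain k where k: "k \<in> heis_indices n" "v = unit_vec k"
      unfolding B_def by auto
    then have "u v = (\<Sum>b\<in>B. pointwise (*) (u b) b) k" by (simp only: comb if_True)
    then show False using u by simp
  qed
  show "span B = heis n"
  proof
    show "span B \<subseteq> heis n"
      by (rule span_minimal)
        (auto simp: B_def heis_def unit_vec_def subspace_def pointwise_def)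
    show "heis n \<subseteq> span B"
    proof
      fix f :: "heis_index \<Rightarrow> 'a" assume f: "f \<in> heis n"
      define u where "u = (\<lambda>b. f (the_inv (unit_vec :: heis_index \<Rightarrow> heis_index \<Rightarrow> 'a) b))"
      have "u (unit_vec k) = f k" for k
        unfolding u_def by (simp add: the_inv_f_f[OF inj])
      then have "f = (\<Sum>b\<in>B. pointwise (*) (u b) b)"
        using f by (auto simp: fun_eq_iff comb heis_def)
      then show "f \<in> span B"
        by (metis (no_types, lifting) span_base span_scale span_sum)
    qed
  qed
  have "card (heis_indices n) = 2 * n + 1"
    unfolding heis_indices_def
    by (subst card_Un_disjoint, auto)+ (auto simp: card_image inj_on_def)
  then show "card B = 2 * n + 1"
    unfolding B_def by (simp add: card_image[OF inj])
qed

definition faithful_dims :: "('a::field \<Rightarrow> 'v::ab_group_add \<Rightarrow> 'v) \<Rightarrow> nat \<Rightarrow> nat set"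
  where "faithful_dims scale n = {vector_space.dim scale V | V \<rho>.
    faithful_lie_module (pointwise (*)) (heis n) (heis_br n) scale V \<rho>}"

text \<open>Every finite dimensional vector space is isomorphic to a subspace of the space of
  sequences, so it suffices to let \<open>V\<close> range over these to define the minimum.\<close>

definition min_faithful_dim :: "'a::field itself \<Rightarrow> nat \<Rightarrow> nat"
  where "min_faithful_dim F n =
    (LEAST m. m \<in> faithful_dims (pointwise (*) :: 'a \<Rightarrow> (nat \<Rightarrow> 'a) \<Rightarrow> nat \<Rightarrow> 'a) n)"

end

theory Submission
  imports Defs
begin

text \<open>Lower bound: let \<open>V\<close> be faithful and pick \<open>v\<close> with \<open>z v \<noteq> 0\<close>. By rank-nullity for
  \<open>x \<mapsto> x v\<close>, either \<open>dim V \<ge> n + 2\<close> or the annihilator of \<open>v\<close> contains \<open>n\<close> linearly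
  independent elements \<open>a\<^sub>i\<close>. The annihilator is a subalgebra missing \<open>z\<close>, so the functionals
  \<open>[a\<^sub>i, -]\<close> are independent and there are \<open>b\<^sub>j\<close> with \<open>[a\<^sub>i, b\<^sub>j] = \<delta>\<^sub>i\<^sub>j z\<close>. Applying \<open>a\<^sub>i\<close> shows
  that \<open>b\<^sub>1 v, \<dots>, b\<^sub>n v, z v\<close> are independent. If they span \<open>V\<close>, then \<open>v\<close> is a
  multiple of \<open>z v\<close>; expanding \<open>b\<^sub>1 b\<^sub>2 v\<close> and applying \<open>a\<^sub>1 a\<^sub>2\<close> gives \<open>z z v = 0\<close> when \<open>n \<ge> 2\<close>,
  while for \<open>n = 1\<close> expanding \<open>b b v\<close> and applying \<open>a\<close> gives \<open>2 b v \<in> span {z v}\<close>.\<close>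

section \<open>Linear algebra\<close>

context vector_space
begin

text \<open>Independence in the library is a property of sets, to which a repeated vector is
  invisible; for families, injectivity has to be added.\<close>

lemma independent_family_iff:
  assumes "finite I"
  shows "inj_on u I \<and> independent (u ` I) \<longleftrightarrow>
    (\<forall>c. (\<Sum>i\<in>I. scale (c i) (u i)) = 0 \<longrightarrow> (\<forall>i\<in>I. c i = 0))"
proof (intro iffI allI impI ballI)
  fix c i
  assume u: "inj_on u I \<and> independent (u ` I)"
    and c: "(\<Sum>i\<in>I. scale (c i) (u i)) = 0" and i: "i \<in> I"
  have "(\<Sum>x\<in>u ` I. scale (c (the_inv_into I u x)) x) = (\<Sum>i\<in>I. scale (c i) (u i))"
    using u by (subst sum.reindex) (auto simp: the_inv_into_f_f)
  then have "c (the_inv_into I u (u i)) = 0"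
    using u c i assms by (intro independentD[of "u ` I" "u ` I"]) auto
  then show "c i = 0" using u i by (simp add: the_inv_into_f_f)
next
  assume *: "\<forall>c. (\<Sum>i\<in>I. scale (c i) (u i)) = 0 \<longrightarrow> (\<forall>i\<in>I. c i = 0)"
  have inj: "inj_on u I"
  proof (rule inj_onI, rule ccontr)
    fix i j assume ij: "i \<in> I" "j \<in> I" "u i = u j" "i \<noteq> j"
    define c :: "_ \<Rightarrow> 'a" where "c = (\<lambda>k. if k = i then 1 else if k = j then - 1 else 0)"
    have "(\<Sum>k\<in>I. scale (c k) (u k)) = (\<Sum>k\<in>{i, j}. scale (c k) (u k))"
      using ij assms by (intro sum.mono_neutral_right) (auto simp: c_def)
    also have "\<dots> = 0" using ij by (simp add: c_def)
    finally show False using * ij by (force simp: c_def)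
  qed
  moreover have "independent (u ` I)"
  proof (rule independent_if_scalars_zero)
    show "finite (u ` I)" using assms by simp
    fix f x assume "(\<Sum>x\<in>u ` I. scale (f x) x) = 0" "x \<in> u ` I"
    then show "f x = 0" using *[rule_format, of "\<lambda>i. f (u i)"] inj by (auto simp: sum.reindex)
  qed
  ultimately show "inj_on u I \<and> independent (u ` I)" by simp
qed

lemma in_span_familyE:
  assumes "finite I" "w \<in> span (u ` I)"
  obtains c where "w = (\<Sum>i\<in>I. scale (c i) (u i))"
proof -
  have "\<exists>c. w = (\<Sum>i\<in>I. scale (c i) (u i))"
    using assms(2)
  proof (induction rule: span_induct_alt)
    case base
    show ?case by (rule exI[of _ "\<lambda>_. 0"]) simp
  next
    case (step a x y)
    then obtain i c where i: "i \<in> I" "x = u i" and c: "y = (\<Sum>i\<in>I. scale (c i) (u i))" by auto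
    have "(\<Sum>k\<in>I. scale ((if k = i then a else 0) + c k) (u k)) =
        (\<Sum>k\<in>I. (if k = i then scale a (u k) else 0)) + y"
      unfolding c by (subst sum.distrib[symmetric]) (auto intro!: sum.cong simp: scale_left_distrib)
    also have "\<dots> = scale a x + y" using i assms(1) by simp
    finally show ?case by metis
  qed
  then show ?thesis using that by blast
qed

text \<open>Induction on \<open>k\<close> in the manner of Gram-Schmidt. The functionals are
  independent as functions on \<open>L\<close>, which is why the dual vectors can be found inside
  \<open>L\<close>.\<close>

lemma obtains_dual_family:
  fixes \<phi> :: "nat \<Rightarrow> 'b \<Rightarrow> 'a"
  assumes L: "subspace L" and lin: "\<And>i. Vector_Spaces.linear scale (*) (\<phi> i)"
    and indep: "\<And>c. (\<forall>x\<in>L. (\<Sum>i<k. c i * \<phi> i x) = 0) \<Longrightarrow> (\<forall>i<k. c i = 0)"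
  obtains b where "\<And>j. j < k \<Longrightarrow> b j \<in> L"
    "\<And>i j. i < k \<Longrightarrow> j < k \<Longrightarrow> \<phi> i (b j) = (if i = j then 1 else 0)"
proof -
  have add: "\<phi> i (x + y) = \<phi> i x + \<phi> i y" and scl: "\<phi> i (scale c x) = c * \<phi> i x"
    and diff: "\<phi> i (x - y) = \<phi> i x - \<phi> i y" and sum: "\<phi> i (\<Sum>j\<in>A. g j) = (\<Sum>j\<in>A. \<phi> i (g j))"
    for i x y c A and g :: "nat \<Rightarrow> 'b"
  proof -
    interpret Vector_Spaces.linear scale "(*)" "\<phi> i" by (rule lin)
    show "\<phi> i (x + y) = \<phi> i x + \<phi> i y" "\<phi> i (scale c x) = c * \<phi> i x"
      "\<phi> i (x - y) = \<phi> i x - \<phi> i y" "\<phi> i (\<Sum>j\<in>A. g j) = (\<Sum>j\<in>A. \<phi> i (g j))"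
      by (rule local.add, rule local.scale, rule local.diff, rule local.sum)
  qed
  have "\<exists>b. (\<forall>j<k. b j \<in> L) \<and> (\<forall>i<k. \<forall>j<k. \<phi> i (b j) = (if i = j then 1 else 0))"
    using indep
  proof (induction k)
    case 0
    then show ?case by simp
  next
    case (Suc k)
    have "\<forall>i<k. c i = 0" if c: "\<forall>x\<in>L. (\<Sum>i<k. c i * \<phi> i x) = 0" for c
    proof -
      have "\<forall>x\<in>L. (\<Sum>i<Suc k. (if i = k then 0 else c i) * \<phi> i x) = 0"
        using c by simp
      from Suc.prems[OF this] show ?thesis by (metis less_Suc_eq nat_less_le)
    qed
    from Suc.IH[OF this] obtain b where b: "\<And>j. j < k \<Longrightarrow> b j \<in> L"
      "\<And>i j. i < k \<Longrightarrow> j < k \<Longrightarrow> \<phi> i (b j) = (if i = j then 1 else 0)" by blast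
    \<comment> \<open>Otherwise, on \<open>L\<close>, the functional \<phi> \<open>k\<close> would
      be a combination of the earlier ones.\<close>
    have "\<exists>x\<in>L. \<phi> k x \<noteq> (\<Sum>j<k. \<phi> k (b j) * \<phi> j x)"
    proof (rule ccontr)
      assume "\<not> ?thesis"
      then have "\<forall>x\<in>L. (\<Sum>i<Suc k. (if i = k then - 1 else \<phi> k (b i)) * \<phi> i x) = 0"
        by simp
      from Suc.prems[OF this] show False by auto
    qed
    then obtain x where x: "x \<in> L" "\<phi> k x \<noteq> (\<Sum>j<k. \<phi> k (b j) * \<phi> j x)" by blast
    \<comment> \<open>Subtracting the components along the earlier \<open>b j\<close> makes \<phi>
      \<open>i\<close> vanish for \<open>i < k\<close>, while the choice of \<open>x\<close> keeps
      \<phi> \<open>k\<close> nonzero.\<close>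
    define y where "y = x - (\<Sum>j<k. scale (\<phi> j x) (b j))"
    have yL: "y \<in> L" unfolding y_def
      using x b by (intro subspace_diff[OF L] subspace_sum[OF L] subspace_scale[OF L]) auto
    have y0: "\<phi> i y = 0" if "i < k" for i
      using that by (simp add: y_def diff sum scl b(2) if_distrib cong: if_cong)
    have yk: "\<phi> k y \<noteq> 0"
      using x by (simp add: y_def diff sum scl mult.commute)
    define e where "e = scale (inverse (\<phi> k y)) y"
    have e: "e \<in> L" "\<And>i. i < k \<Longrightarrow> \<phi> i e = 0" "\<phi> k e = 1"
      using yL y0 yk by (auto simp: e_def scl subspace_scale[OF L])
    define b' where "b' j = (if j = k then e else b j - scale (\<phi> k (b j)) e)" for j
    have "b' j \<in> L" if "j < Suc k" for j
      using that e(1) b(1)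
      by (auto simp: b'_def less_Suc_eq intro!: subspace_diff[OF L] subspace_scale[OF L])
    moreover have "\<phi> i (b' j) = (if i = j then 1 else 0)" if "i < Suc k" "j < Suc k" for i j
      using that e b(2) by (auto simp: b'_def less_Suc_eq diff scl)
    ultimately show ?case by blast
  qed
  then show ?thesis using that by blast
qed

end

text \<open>Rank-nullity as an inequality: a basis \<open>C\<close> of the kernel extends to a basis
  \<open>B\<close> of the span of \<open>D\<close>, and \<open>f\<close> maps \<open>B - C\<close>
  injectively to an independent set in the span of \<open>E\<close>, so \<open>B - C\<close> has at
  most \<open>card E\<close> elements.\<close>

lemma (in vector_space_pair) obtains_independent_in_kernel:
  assumes f: "Vector_Spaces.linear s1 s2 f" and D: "vs1.independent D" "finite D"
    and E: "finite E" "f ` D \<subseteq> vs2.span E"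
  obtains C where "C \<subseteq> {x \<in> vs1.span D. f x = 0}" "vs1.independent C" "finite C"
    "card D \<le> card C + card E"
proof -
  interpret f: Vector_Spaces.linear s1 s2 f by (rule f)
  define K where "K = {x \<in> vs1.span D. f x = 0}"
  obtain C where C: "C \<subseteq> K" "vs1.independent C" "K \<subseteq> vs1.span C"
    using vs1.maximal_independent_subset[of K] by blast
  have CD: "C \<subseteq> vs1.span D" using C(1) by (auto simp: K_def)
  obtain B where B: "C \<subseteq> B" "B \<subseteq> vs1.span D" "vs1.independent B" "vs1.span D \<subseteq> vs1.span B"
    using vs1.maximal_independent_subset_extend[OF CD C(2)] by blast
  have fin: "finite B" using vs1.independent_span_bound[OF D(2) B(3,2)] by simp
  have "D \<subseteq> vs1.span B" using B(4) vs1.span_superset[of D] by blast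
  from vs1.independent_span_bound[OF fin D(1) this] have DB: "card D \<le> card B" by simp
  have sub: "vs1.subspace (vs1.span (B - C))" by simp
  have sBD: "vs1.span (B - C) \<subseteq> vs1.span D"
    using B(2) by (intro vs1.span_minimal) auto
  have inj: "inj_on f (vs1.span (B - C))"
    unfolding f.inj_on_iff_eq_0[OF sub]
  proof (intro ballI impI)
    fix x assume x: "x \<in> vs1.span (B - C)" "f x = 0"
    then have "x \<in> vs1.span C" using sBD C(3) by (auto simp: K_def)
    then obtain p where p: "x = (\<Sum>v\<in>C. s1 (p v) v)"
      using vs1.in_span_familyE[of C x "\<lambda>v. v"] finite_subset[OF B(1) fin] by auto
    obtain q where q: "x = (\<Sum>v\<in>B - C. s1 (q v) v)"
      using vs1.in_span_familyE[of "B - C" x "\<lambda>v. v"] fin x by auto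
    \<comment> \<open>The two expansions of \<open>x\<close>, over \<open>C\<close> and over
      \<open>B - C\<close>, are subtracted to give a relation over the independent set
      \<open>B\<close>.\<close>
    have "(\<Sum>v\<in>B. s1 (if v \<in> C then p v else - q v) v) =
      (\<Sum>v\<in>B - C. s1 (- q v) v) + (\<Sum>v\<in>C. s1 (p v) v)"
      by (subst sum.subset_diff[OF B(1) fin]) simp
    also have "\<dots> = 0" using p q by (simp add: sum_negf)
    finally have "\<forall>v\<in>B. (if v \<in> C then p v else - q v) = 0"
      using vs1.independentD[OF B(3) fin order.refl, of "\<lambda>v. if v \<in> C then p v else - q v"]
      by blast
    then have "\<forall>v\<in>C. p v = 0" using B(1) by force
    then show "x = 0" using p by simp
  qed
  have "vs2.independent (f ` (B - C))"
    using B(3) by (intro f.independent_injective_image[OF _ inj])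
      (metis Diff_subset vs1.dependent_mono)
  moreover have "f ` (B - C) \<subseteq> vs2.span E"
  proof -
    have "f ` (B - C) \<subseteq> f ` vs1.span D" using B(2) by auto
    also have "\<dots> = vs2.span (f ` D)" by (rule f.span_image[symmetric])
    also have "\<dots> \<subseteq> vs2.span E" using E(2) by (intro vs2.span_minimal) auto
    finally show ?thesis .
  qed
  ultimately have "card (f ` (B - C)) \<le> card E"
    using vs2.independent_span_bound[OF E(1)] by blast
  moreover have "card (f ` (B - C)) = card (B - C)"
    by (rule card_image) (rule inj_on_subset[OF inj vs1.span_superset])
  moreover have "card (B - C) = card B - card C"
    using B(1) fin by (simp add: card_Diff_subset finite_subset)
  ultimately have "card D \<le> card C + card E" using DB by simp
  then show ?thesis
    using that[of C] C finite_subset[OF B(1) fin] by (auto simp: K_def)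
qed


section \<open>The lower bound\<close>

context vector_space
begin

section \<open>Rules for computing with endomorphisms of \<open>V\<close>\<close>

lemma gl_closed: "f \<in> gl scale V \<Longrightarrow> w \<in> V \<Longrightarrow> f w \<in> V"
  by (auto simp: gl_def)

lemma gl_add: "f \<in> gl scale V \<Longrightarrow> w \<in> V \<Longrightarrow> w' \<in> V \<Longrightarrow> f (w + w') = f w + f w'"
  by (simp add: gl_def)

lemma gl_scale: "f \<in> gl scale V \<Longrightarrow> w \<in> V \<Longrightarrow> f (scale c w) = scale c (f w)"
  by (simp add: gl_def)

lemma gl_zero: "f \<in> gl scale V \<Longrightarrow> subspace V \<Longrightarrow> f 0 = 0"
  using gl_scale[of f V 0 0] subspace_0 by simp

lemma gl_sum:
  assumes f: "f \<in> gl scale V" and V: "subspace V" and w: "\<And>i. i \<in> I \<Longrightarrow> w i \<in> V"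
  shows "f (\<Sum>i\<in>I. scale (c i) (w i)) = (\<Sum>i\<in>I. scale (c i) (f (w i)))"
  using w
proof (induction I rule: infinite_finite_induct)
  case (insert i I)
  then show ?case
    by (simp add: gl_add[OF f] gl_scale[OF f] subspace_scale[OF V] subspace_sum[OF V])
qed (simp_all add: gl_zero[OF f V])

text \<open>Stated for operators alone, so that choosing the \<open>a i\<close> in the annihilator
  of \<open>v\<close> and their duals \<open>b i\<close> is a separate matter. The finite spanning
  set \<open>E\<close> makes \<open>dim V\<close> a bound on the size of independent
  subsets.\<close>

lemma heisenberg_pairs_dim:
  fixes a b :: "nat \<Rightarrow> 'b \<Rightarrow> 'b"
  assumes V: "subspace V" and E: "finite E" "span E = V" and n: "n \<ge> 1"
    and a: "\<And>i. i < n \<Longrightarrow> a i \<in> gl scale V" and b: "\<And>i. i < n \<Longrightarrow> b i \<in> gl scale V"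
    and z: "z \<in> gl scale V"
    and ab: "\<And>i j w. i < n \<Longrightarrow> j < n \<Longrightarrow> w \<in> V \<Longrightarrow>
      a i (b j w) = b j (a i w) + (if i = j then z w else 0)"
    and az: "\<And>i w. i < n \<Longrightarrow> w \<in> V \<Longrightarrow> a i (z w) = z (a i w)"
    and bz: "\<And>i w. i < n \<Longrightarrow> w \<in> V \<Longrightarrow> b i (z w) = z (b i w)"
    and v: "v \<in> V" "z v \<noteq> 0" "\<And>i. i < n \<Longrightarrow> a i v = 0"
  shows "n + 2 \<le> dim V \<or> n = 1 \<and> (2 :: 'a) = 0 \<and> 2 \<le> dim V"
proof -
  note clo = gl_closed[OF a] gl_closed[OF b] gl_closed[OF z]
  note zero = gl_zero[OF a V] gl_zero[OF b V] gl_zero[OF z V]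
  \<comment> \<open>Index \<open>n\<close>, the last one below \<open>Suc n\<close>, stands for
    \<open>z v\<close>.\<close>
  define u where "u j = (if j < n then b j v else z v)" for j
  have uV: "u j \<in> V" for j using v by (auto simp: u_def clo)
  have au: "a i (u j) = (if i = j then z v else 0)" if "i < n" for i j
    using that v by (auto simp: u_def ab az zero)
  \<comment> \<open>Each \<open>a i\<close> kills \<open>v\<close> and commutes with
    \<open>z\<close>, so it sends a combination of the \<open>u j\<close> to its \<open>i\<close>-th
    coefficient times \<open>z v\<close>.\<close>
  have coef: "a i (\<Sum>j<Suc n. scale (c j) (u j)) = scale (c i) (z v)" if "i < n" for i c
  proof -
    have "a i (\<Sum>j<Suc n. scale (c j) (u j)) = (\<Sum>j<Suc n. scale (c j) (a i (u j)))"
      by (rule gl_sum[OF a[OF that] V uV])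
    also have "\<dots> = (\<Sum>j<Suc n. if i = j then scale (c j) (z v) else 0)"
      by (rule sum.cong) (simp_all add: au[OF that])
    also have "\<dots> = scale (c i) (z v)" using that by (simp del: sum.lessThan_Suc)
    finally show ?thesis .
  qed
  have indep: "\<forall>i\<in>{..<Suc n}. c i = 0" if c: "(\<Sum>j<Suc n. scale (c j) (u j)) = 0" for c
  proof -
    have *: "c i = 0" if "i < n" for i
      using coef[OF that, of c] v(2) that by (simp add: c zero del: sum.lessThan_Suc)
    with c v(2) have "c n = 0" by (simp add: u_def)
    with * show ?thesis by (auto simp: less_Suc_eq)
  qed
  then have ind: "inj_on u {..<Suc n}" "independent (u ` {..<Suc n})"
    using independent_family_iff[of "{..<Suc n}" u] by auto
  then have card: "card (u ` {..<Suc n}) = n + 1" by (simp add: card_image)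
  obtain E' where E': "E' \<subseteq> V" "independent E'" "V \<subseteq> span E'" "card E' = dim V"
    using basis_exists[of V] by blast
  then have fin: "finite E'"
    using independent_span_bound[OF E(1)] E(2) by blast
  have bound: "card B \<le> dim V" if "B \<subseteq> V" "independent B" for B
    using independent_span_bound[OF fin that(2)] that(1) E' by auto
  have uV': "u ` {..<Suc n} \<subseteq> V" using uV by blast
  have lower: "n + 1 \<le> dim V" using bound[OF uV' ind(2)] card by simp
  show ?thesis
  proof (rule ccontr)
    assume contra: "\<not> ?thesis"
    \<comment> \<open>A vector outside the span would give \<open>n + 2\<close> independent vectors
      in \<open>V\<close>.\<close>
    have "w \<in> span (u ` {..<Suc n})" if "w \<in> V" for w
    proof (rule ccontr)
      assume w: "w \<notin> span (u ` {..<Suc n})"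
      have "card (insert w (u ` {..<Suc n})) \<le> dim V"
        using that uV' by (intro bound independent_insertI w ind) auto
      moreover have "w \<notin> u ` {..<Suc n}" by (metis w span_base)
      ultimately have "n + 2 \<le> dim V"
        using card card_insert_disjoint[of "u ` {..<Suc n}" w] by simp
      then show False using contra by simp
    qed
    then have expand: "\<exists>c. w = (\<Sum>j<Suc n. scale (c j) (u j))" if "w \<in> V" for w
      using in_span_familyE[of "{..<Suc n}" w u] that by (metis finite_lessThan)
    obtain c where c: "v = (\<Sum>j<Suc n. scale (c j) (u j))" using expand v(1) by blast
    \<comment> \<open>Since \<open>a i\<close> kills \<open>v\<close>, only the coefficient of
      \<open>z v\<close> can survive; thus \<open>v\<close> is a multiple of
      \<open>z v\<close>.\<close>
    have "c i = 0" if "i < n" for i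
      using coef[OF that, of c] v(2) v(3)[OF that] by (simp add: c[symmetric] del: sum.lessThan_Suc)
    then have v_eq: "scale (c n) (z v) = v" using c by (simp add: u_def)
    show False
    proof (cases "n = 1")
      case True
      have 0: "0 < n" using n by simp
      obtain d where d: "b 0 (b 0 v) = (\<Sum>j<Suc n. scale (d j) (u j))"
        using expand[of "b 0 (b 0 v)"] v(1) 0 by (auto simp: clo)
      \<comment> \<open>Moving \<open>a 0\<close> past both factors \<open>b 0\<close> produces
        \<open>z\<close> twice. Multiplication by \<open>c n\<close> then cancels one
        \<open>z\<close> next to \<open>v\<close>.\<close>
      have "scale (d 0) (z v) = a 0 (b 0 (b 0 v))" using coef[OF 0, of d] d by simp
      also have "\<dots> = b 0 (z v) + z (b 0 v)"
        using 0 v by (simp add: ab clo zero)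
      also have "\<dots> = scale 2 (b 0 (z v))"
        using 0 v scale_left_distrib[of 1 1] by (simp add: bz)
      finally have "scale (c n) (scale 2 (b 0 (z v))) = scale (c n) (scale (d 0) (z v))"
        by simp
      moreover have "scale (c n) (b 0 (z v)) = b 0 v"
        using gl_scale[OF b[OF 0], of "z v" "c n"] v(1) clo(3) v_eq by simp
      ultimately have "scale 2 (b 0 v) = scale (c n * d 0) (z v)"
        by (metis scale_left_commute scale_scale)
      \<comment> \<open>As \<open>n = 1\<close>, index 0 is \<open>b 0 v\<close> and index 1 is
        \<open>z v\<close>; independence forces the coefficient 2 to be 0.\<close>
      then have "(\<Sum>j<Suc n. scale (if j = 0 then 2 else - (c n * d 0)) (u j)) = 0"
        using True by (simp add: u_def)
      from indep[OF this] have "(2 :: 'a) = 0" by force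
      then show False using contra True lower by simp
    next
      case False
      then have 01: "0 < n" "1 < n" using n by auto
      obtain d where d: "b 0 (b 1 v) = (\<Sum>j<Suc n. scale (d j) (u j))"
        using expand[of "b 0 (b 1 v)"] v(1) 01 by (auto simp: clo)
      have "scale (d 1) (z v) = a 1 (b 0 (b 1 v))" using coef[OF 01(2), of d] d by simp
      also have "\<dots> = b 0 (z v)"
        using 01 v by (simp add: ab clo zero)
      \<comment> \<open>The left side vanishes because \<open>a 0\<close> kills \<open>v\<close>;
        the right side is \<open>z (z v)\<close>.\<close>
      finally have "a 0 (scale (d 1) (z v)) = a 0 (b 0 (z v))" by simp
      then have "z (z v) = 0"
        using 01 v by (simp add: ab az clo zero gl_scale[OF a])
      then have "z v = 0"
        using v_eq gl_scale[OF z, of "z v" "c n"] v(1) clo(3) by simp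
      then show False using v(2) by simp
    qed
  qed
qed

end

section \<open>From a faithful Heisenberg module to dual pairs of operators\<close>

lemma unit_vec_in_heis: "k \<in> heis_indices n \<Longrightarrow> unit_vec k \<in> heis n"
  by (auto simp: heis_def unit_vec_def)

text \<open>Brackets with the basis read off all coordinates of \<open>f\<close> except the one at
  \<open>Z\<close>, so an element for which they all vanish is a multiple of the central basis
  vector.\<close>

lemma heis_br_unit_vec:
  fixes f :: "heis_index \<Rightarrow> 'a::field"
  assumes "i < n"
  shows "heis_br n f (unit_vec (Y i)) Z = f (X i)" "heis_br n f (unit_vec (X i)) Z = - f (Y i)"
proof -
  have "c * (if P then 1 else 0) = (if P then c else 0)" for c :: 'a and P by simp
  then show "heis_br n f (unit_vec (Y i)) Z = f (X i)" "heis_br n f (unit_vec (X i)) Z = - f (Y i)"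
    using assms by (simp_all add: heis_br_def unit_vec_def sum_negf)
qed

lemma heis_br_eq: "heis_br n f g = pointwise (*) (heis_br n f g Z) (unit_vec Z)"
  by (auto simp: heis_br_def pointwise_def unit_vec_def)

text \<open>If \<open>dim V\<close> is at most \<open>n + 1\<close>, the annihilator of a suitable
  \<open>v\<close> provides the elements \<open>a i\<close>, duality provides the
  \<open>b i\<close>, and \<open>heisenberg_pairs_dim\<close> applies to their images under
  \<rho>.\<close>

lemma faithful_heis_module_dim:
  fixes scale :: "'a::field \<Rightarrow> 'v::ab_group_add \<Rightarrow> 'v"
  assumes "faithful_lie_module (pointwise (*)) (heis n) (heis_br n) scale V \<rho>" and n: "n \<ge> 1"
  shows "n + 2 \<le> vector_space.dim scale V \<or>
    n = 1 \<and> (2 :: 'a) = 0 \<and> 2 \<le> vector_space.dim scale V"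
proof (cases "n + 2 \<le> vector_space.dim scale V")
  case False
  interpret H: vector_space "pointwise (*) :: 'a \<Rightarrow> (heis_index \<Rightarrow> 'a) \<Rightarrow> heis_index \<Rightarrow> 'a"
    by (rule vector_space_coords)
  interpret M: faithful_lie_module "pointwise (*)" "heis n" "heis_br n" scale V \<rho> by fact
  interpret P: vector_space_pair
    "pointwise (*) :: 'a \<Rightarrow> (heis_index \<Rightarrow> 'a) \<Rightarrow> heis_index \<Rightarrow> 'a" scale ..
  let ?h = "heis n :: (heis_index \<Rightarrow> 'a) set"
  let ?e = "unit_vec Z :: heis_index \<Rightarrow> 'a"
  have XY: "X i \<in> heis_indices n" "Y i \<in> heis_indices n" if "i < n" for i
    using that by (auto simp: heis_indices_def)
  have e: "?e \<in> ?h" by (rule unit_vec_in_heis) (simp add: heis_indices_def)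
  have rep: "\<rho> x (\<rho> y w) = \<rho> y (\<rho> x w) + scale (heis_br n x y Z) (\<rho> ?e w)"
    if "x \<in> ?h" "y \<in> ?h" for x y w
  proof -
    have "commutator (\<rho> x) (\<rho> y) = \<rho> (pointwise (*) (heis_br n x y Z) ?e)"
      using M.rep.map_br[OF that] heis_br_eq[of n x y] by simp
    also have "\<dots> = pointwise scale (heis_br n x y Z) (\<rho> ?e)"
      by (rule M.rep.map_scale[OF e])
    finally show ?thesis by (auto simp: commutator_def pointwise_def fun_eq_iff algebra_simps)
  qed
  have "(0 :: heis_index \<Rightarrow> 'a) \<in> ?h" by (simp add: heis_def)
  moreover from M.rep.map_add[OF this this] have "\<rho> 0 = 0" by simp
  moreover have "?e \<noteq> 0" by (auto simp: unit_vec_def fun_eq_iff)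
  ultimately have "\<rho> ?e \<noteq> 0" using inj_onD[OF M.faithful _ e] by metis
  then obtain v where v: "\<rho> ?e v \<noteq> 0" by (auto simp: fun_eq_iff)
  then have vV: "v \<in> V" using M.rep.maps_to[OF e] by (auto simp: gl_def)
  \<comment> \<open>\<rho> is linear only on \<open>heis n\<close>; discarding the other coordinates
    extends \<open>x \<mapsto> \<rho> x v\<close> to a linear map on the whole ambient type.\<close>
  define f where "f x = \<rho> (\<lambda>k. if k \<in> heis_indices n then x k else 0) v" for x
  have f_eq: "f x = \<rho> x v" if "x \<in> ?h" for x
  proof -
    have "(\<lambda>k. if k \<in> heis_indices n then x k else 0) = x" using that by (auto simp: heis_def)
    then show ?thesis by (simp add: f_def)
  qed
  have f: "Vector_Spaces.linear (pointwise (*)) scale f"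
    unfolding Vector_Spaces.linear_iff
  proof (intro conjI allI)
    fix x y :: "heis_index \<Rightarrow> 'a" and c
    let ?r = "\<lambda>x k. if k \<in> heis_indices n then x k else (0 :: 'a)"
    have r: "?r x \<in> ?h" for x by (simp add: heis_def)
    have "?r (x + y) = ?r x + ?r y" by (simp add: fun_eq_iff)
    then show "f (x + y) = f x + f y" by (simp add: f_def M.rep.map_add[OF r r])
    have "?r (pointwise (*) c x) = pointwise (*) c (?r x)" by (simp add: fun_eq_iff pointwise_def)
    then show "f (pointwise (*) c x) = scale c (f x)"
      by (simp add: f_def M.rep.map_scale[OF r]) (simp add: pointwise_def)
  qed (fact vector_space_coords M.vector_space_axioms)+
  interpret f: Vector_Spaces.linear "pointwise (*)" scale f by (rule f)
  obtain E where E: "finite E" "M.span E = V" using M.finite_dim by blast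
  obtain E' where E': "E' \<subseteq> V" "M.independent E'" "V \<subseteq> M.span E'" "card E' = M.dim V"
    using M.basis_exists[of V] by blast
  then have fin: "finite E'" using M.independent_span_bound[OF E(1)] E(2) by blast
  let ?D = "unit_vec ` heis_indices n :: (heis_index \<Rightarrow> 'a) set"
  note D = heis_basis[where n = n and 'a = 'a]
  have "f ` ?D \<subseteq> V"
  proof (rule image_subsetI, erule imageE)
    fix x :: "heis_index \<Rightarrow> 'a" and k assume "x = unit_vec k" "k \<in> heis_indices n"
    then have x: "x \<in> ?h" by (simp add: unit_vec_in_heis)
    show "f x \<in> V" unfolding f_eq[OF x] by (rule M.gl_closed[OF M.rep.maps_to[OF x] vV])
  qed
  then have "f ` ?D \<subseteq> M.span E'" using E'(3) by blast
  from P.obtains_independent_in_kernel[OF f D(1) _ fin this]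
  obtain C where C: "C \<subseteq> {x \<in> ?h. f x = 0}" "H.independent C" "finite C" "2 * n + 1 \<le> card C + M.dim V"
    using D E'(4) by (auto simp: heis_indices_def)
  obtain a where a: "bij_betw a {0..<card C} C"
    using ex_bij_betw_nat_finite[OF C(3)] by blast
  \<comment> \<open>Here \<open>dim V \<le> n + 1\<close>, and
    \<open>(2 * n + 1) - (n + 1) = n\<close>.\<close>
  have nC: "n \<le> card C" using C(4) False by simp
  then have sub: "{..<n} \<subseteq> {0..<card C}" by auto
  have aC: "a ` {..<n} \<subseteq> C" using a sub by (auto simp: bij_betw_def)
  have a_h: "a i \<in> ?h" and fa: "f (a i) = 0" if "i < n" for i
    using aC C(1) that by auto
  have ind: "inj_on a {..<n}" "H.independent (a ` {..<n})"
    using inj_on_subset[OF bij_betw_imp_inj_on[OF a] sub] H.independent_mono[OF C(2) aC] by auto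
  define \<phi> where "\<phi> i x = heis_br n (a i) x Z" for i x
  have lin: "Vector_Spaces.linear (pointwise (*)) (*) (\<phi> i)" for i
  proof -
    have "vector_space ((*) :: 'a \<Rightarrow> 'a \<Rightarrow> 'a)" by unfold_locales (auto simp: algebra_simps)
    then show ?thesis
      unfolding Vector_Spaces.linear_iff
      by (intro conjI vector_space_coords)
        (auto simp: \<phi>_def heis_br_def pointwise_def sum.distrib[symmetric] sum_distrib_left
          algebra_simps intro!: sum.cong)
  qed
  \<comment> \<open>A relation between the functionals gives a combination \<open>y\<close> of the
    \<open>a i\<close> whose brackets all vanish, hence a multiple of the central vector. But
    \<open>f y = 0\<close>, whereas the central vector moves \<open>v\<close> to a nonzero vector;
    so \<open>y = 0\<close>.\<close>
  have indep: "\<forall>i<n. c i = 0" if c: "\<forall>x\<in>?h. (\<Sum>i<n. c i * \<phi> i x) = 0" for c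
  proof -
    define y where "y = (\<Sum>i<n. pointwise (*) (c i) (a i))"
    have y_apply: "y k = (\<Sum>i<n. c i * a i k)" for k
      unfolding y_def by (induction n) (auto simp: pointwise_def)
    have y_h: "y \<in> ?h" unfolding y_def
      using a_h by (intro H.subspace_sum H.subspace_scale M.rep.dom.subspace_L) auto
    have "y (X j) = 0" "y (Y j) = 0" if j: "j < n" for j
      using c[rule_format, OF unit_vec_in_heis[OF XY(2)[OF j]]]
        c[rule_format, OF unit_vec_in_heis[OF XY(1)[OF j]]]
      by (simp_all add: \<phi>_def heis_br_unit_vec[OF j] y_apply sum_negf)
    then have y: "y = pointwise (*) (y Z) ?e"
      using y_h by (auto simp: fun_eq_iff pointwise_def unit_vec_def heis_def heis_indices_def)
    have "f y = (\<Sum>i<n. scale (c i) (f (a i)))" unfolding y_def by (simp add: f.sum f.scale)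
    also have "\<dots> = 0" by (simp add: fa)
    finally have "scale (y Z) (\<rho> ?e v) = 0"
      using f.scale[of "y Z" ?e] y f_eq[OF e] by simp
    then have "y = 0" using v y by simp
    then show ?thesis
      using H.independent_family_iff[of "{..<n}" a] ind by (auto simp: y_def)
  qed
  from H.obtains_dual_family[where \<phi> = \<phi> and k = n, OF M.rep.dom.subspace_L lin indep]
  obtain b where b: "\<And>j. j < n \<Longrightarrow> b j \<in> ?h"
    "\<And>i j. i < n \<Longrightarrow> j < n \<Longrightarrow> \<phi> i (b j) = (if i = j then 1 else 0)" by blast
  have e_central: "heis_br n x ?e Z = 0" for x by (simp add: heis_br_def unit_vec_def)
  show ?thesis
  proof (rule M.heisenberg_pairs_dim[OF M.subspace_V E n, of "\<lambda>i. \<rho> (a i)" "\<lambda>i. \<rho> (b i)" "\<rho> ?e" v])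
    show "\<rho> (a i) (\<rho> (b j) w) = \<rho> (b j) (\<rho> (a i) w) + (if i = j then \<rho> ?e w else 0)"
      if "i < n" "j < n" for i j w
      using rep[OF a_h b(1)] b(2) that by (simp add: \<phi>_def)
    show "\<rho> (a i) (\<rho> ?e w) = \<rho> ?e (\<rho> (a i) w)" if "i < n" for i w
      using rep[OF a_h e] that by (simp add: e_central)
    show "\<rho> (b i) (\<rho> ?e w) = \<rho> ?e (\<rho> (b i) w)" if "i < n" for i w
      using rep[OF b(1) e] that by (simp add: e_central)
    show "\<rho> (a i) v = 0" if "i < n" for i
      using fa[OF that] f_eq[OF a_h[OF that]] by simp
  qed (use M.rep.maps_to a_h b(1) e v vV in auto)
qed simp

section \<open>Faithful modules of minimum dimension\<close>

text \<open>A copy of the \<open>m\<close>-dimensional coordinate space among the sequences, the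
  ambient space used by \<open>min_faithful_dim\<close>.\<close>

definition coord_space :: "nat \<Rightarrow> (nat \<Rightarrow> 'a::field) set"
  where "coord_space m = {v. \<forall>k\<ge>m. v k = 0}"

lemma coord_space:
  fixes m :: nat
  defines "V \<equiv> coord_space m :: (nat \<Rightarrow> 'a::field) set"
  shows "module.subspace (pointwise (*)) V" "module.span (pointwise (*)) (unit_vec ` {..<m}) = V"
    "vector_space.dim (pointwise (*)) V = m"
proof -
  interpret vector_space "pointwise (*) :: 'a \<Rightarrow> (nat \<Rightarrow> 'a) \<Rightarrow> nat \<Rightarrow> 'a"
    by (rule vector_space_coords)
  let ?u = "unit_vec :: nat \<Rightarrow> nat \<Rightarrow> 'a"
  have comb: "(\<Sum>i<m. pointwise (*) (c i) (?u i)) k = (if k < m then c k else 0)" for c k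
    by (induction m) (auto simp: pointwise_def unit_vec_def less_Suc_eq)
  show V: "subspace V"
    by (auto simp: V_def coord_space_def subspace_def pointwise_def)
  show span: "span (?u ` {..<m}) = V"
  proof (rule span_subspace[OF _ _ V])
    show "?u ` {..<m} \<subseteq> V" by (auto simp: V_def coord_space_def unit_vec_def)
    show "V \<subseteq> span (?u ` {..<m})"
    proof
      fix v assume "v \<in> V"
      then have "v = (\<Sum>i<m. pointwise (*) (v i) (?u i))"
        by (auto simp: fun_eq_iff comb V_def coord_space_def)
      also have "\<dots> \<in> span (?u ` {..<m})"
        by (intro span_sum span_scale span_base) auto
      finally show "v \<in> span (?u ` {..<m})" .
    qed
  qed
  have "inj_on ?u {..<m} \<and> independent (?u ` {..<m})"
    unfolding independent_family_iff[OF finite_lessThan]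
  proof (intro allI impI ballI)
    fix c :: "nat \<Rightarrow> 'a" and i
    assume "(\<Sum>i<m. pointwise (*) (c i) (?u i)) = 0" "i \<in> {..<m}"
    then show "c i = 0" using comb[of c i] by simp
  qed
  then show "dim V = m"
    using dim_span_eq_card_independent[of "?u ` {..<m}"] span by (simp add: card_image)
qed

text \<open>The axioms on both algebras and the dimension are settled here once, leaving each
  construction to check that its map is an injective homomorphism.\<close>

lemma coord_space_faithful_dimsI:
  fixes \<rho> :: "(heis_index \<Rightarrow> 'a::field) \<Rightarrow> (nat \<Rightarrow> 'a) \<Rightarrow> nat \<Rightarrow> 'a"
  assumes "\<And>f. f \<in> heis n \<Longrightarrow> \<rho> f \<in> gl (pointwise (*)) (coord_space m)"
    and "\<And>f g. f \<in> heis n \<Longrightarrow> g \<in> heis n \<Longrightarrow> \<rho> (f + g) = \<rho> f + \<rho> g"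
    and "\<And>f c. f \<in> heis n \<Longrightarrow> \<rho> (pointwise (*) c f) = pointwise (pointwise (*)) c (\<rho> f)"
    and "\<And>f g. f \<in> heis n \<Longrightarrow> g \<in> heis n \<Longrightarrow> \<rho> (heis_br n f g) = commutator (\<rho> f) (\<rho> g)"
    and "inj_on \<rho> (heis n)"
  shows "m \<in> faithful_dims (pointwise (*) :: 'a \<Rightarrow> (nat \<Rightarrow> 'a) \<Rightarrow> nat \<Rightarrow> 'a) n"
proof -
  have "lie_hom (pointwise (*)) (heis n) (heis_br n)
      (pointwise (pointwise (*))) (gl (pointwise (*)) (coord_space m)) commutator \<rho>"
    by (intro lie_hom.intro lie_algebra_heis lie_algebra_gl vector_space_coords coord_space
        lie_hom_axioms.intro assms)
  then have "faithful_lie_module (pointwise (*)) (heis n) (heis_br n) (pointwise (*)) (coord_space m) \<rho>"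
    by (intro faithful_lie_module.intro lie_module.intro lie_module_axioms.intro
        faithful_lie_module_axioms.intro vector_space_coords coord_space assms(5)
        exI[of _ "unit_vec ` {..<m}"] conjI finite_imageI finite_lessThan)
  then show ?thesis
    unfolding faithful_dims_def
    by (intro CollectI exI conjI) (rule coord_space(3)[symmetric])
qed

lemma coord_space_closed:
  "u \<in> coord_space m \<Longrightarrow> v \<in> coord_space m \<Longrightarrow> u + v \<in> coord_space m"
  "v \<in> coord_space m \<Longrightarrow> (\<lambda>i. c * v i) \<in> coord_space m"
  by (simp_all add: coord_space_def)

lemma unit_vec_in_coord_space: "k < m \<Longrightarrow> unit_vec k \<in> coord_space m"
  by (simp add: coord_space_def unit_vec_def)

text \<open>By matrix units, with rows and columns numbered \<open>0, \<dots>, n + 1\<close>: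
  \<open>x\<^sub>i \<mapsto> E\<^sub>0\<^sub>,\<^sub>i\<^sub>+\<^sub>1\<close>, \<open>y\<^sub>i \<mapsto> E\<^sub>i\<^sub>+\<^sub>1\<^sub>,\<^sub>n\<^sub>+\<^sub>1\<close>, \<open>z \<mapsto> E\<^sub>0\<^sub>,\<^sub>n\<^sub>+\<^sub>1\<close>.\<close>

definition heis_rep :: "nat \<Rightarrow> (heis_index \<Rightarrow> 'a::field) \<Rightarrow> (nat \<Rightarrow> 'a) \<Rightarrow> nat \<Rightarrow> 'a"
  where "heis_rep n f v = (if v \<in> coord_space (n + 2) then
    (\<lambda>k. case k of 0 \<Rightarrow> (\<Sum>i<n. f (X i) * v (Suc i)) + f Z * v (Suc n)
      | Suc i \<Rightarrow> if i < n then f (Y i) * v (Suc n) else 0)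
    else 0)"

lemma heis_rep_in_coord_space: "heis_rep n f v \<in> coord_space (n + 2)"
  by (auto simp: heis_rep_def coord_space_def split: nat.split)

text \<open>The matrix units for \<open>x\<close> and \<open>y\<close> multiply to the one for
  \<open>z\<close> in one order and to 0 in the other. All of them sit at different positions, so
  the matrix determines the coordinates.\<close>

lemma heis_faithful_dim: "n + 2 \<in> faithful_dims (pointwise (*) :: 'a::field \<Rightarrow> (nat \<Rightarrow> 'a) \<Rightarrow> nat \<Rightarrow> 'a) n"
proof (rule coord_space_faithful_dimsI[where \<rho> = "heis_rep n"])
  fix f g :: "heis_index \<Rightarrow> 'a" and c
  show "heis_rep n f \<in> gl (pointwise (*)) (coord_space (n + 2))"
    unfolding gl_def pointwise_def
  proof (intro CollectI conjI ballI allI impI Pi_I)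
    fix u v :: "nat \<Rightarrow> 'a"
    assume uv: "u \<in> coord_space (n + 2)" "v \<in> coord_space (n + 2)"
    show "heis_rep n f (u + v) = heis_rep n f u + heis_rep n f v"
      using uv coord_space_closed(1)[OF uv]
      by (simp add: heis_rep_def fun_eq_iff sum.distrib algebra_simps split: nat.split)
  next
    fix c and v :: "nat \<Rightarrow> 'a"
    assume v: "v \<in> coord_space (n + 2)"
    show "heis_rep n f (\<lambda>i. c * v i) = (\<lambda>i. c * heis_rep n f v i)"
      using v coord_space_closed(2)[OF v, of c]
      by (simp add: heis_rep_def fun_eq_iff sum_distrib_left algebra_simps split: nat.split)
  qed (simp_all only: heis_rep_in_coord_space, simp add: heis_rep_def)
  show "heis_rep n (f + g) = heis_rep n f + heis_rep n g"
    by (auto simp: heis_rep_def fun_eq_iff sum.distrib algebra_simps split: nat.split)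
  show "heis_rep n (pointwise (*) c f) = pointwise (pointwise (*)) c (heis_rep n f)"
    by (auto simp: heis_rep_def fun_eq_iff pointwise_def sum_distrib_left algebra_simps split: nat.split)
  show "heis_rep n (heis_br n f g) = commutator (heis_rep n f) (heis_rep n g)"
  proof (intro ext)
    fix v :: "nat \<Rightarrow> 'a" and k
    show "heis_rep n (heis_br n f g) v k = commutator (heis_rep n f) (heis_rep n g) v k"
    proof (cases "v \<in> coord_space (n + 2)")
      case True
      have action: "heis_rep n f v k = (case k of 0 \<Rightarrow> (\<Sum>i<n. f (X i) * v (Suc i)) + f Z * v (Suc n)
          | Suc i \<Rightarrow> if i < n then f (Y i) * v (Suc n) else 0)"
        if "v \<in> coord_space (n + 2)" for f :: "heis_index \<Rightarrow> 'a" and v k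
        using that by (simp add: heis_rep_def)
      show ?thesis
        by (simp add: commutator_def action[OF True] action[OF heis_rep_in_coord_space] heis_br_def
            sum_subtractf sum_distrib_left algebra_simps split: nat.split)
    next
      case False
      \<comment> \<open>Equality is also needed off the module, where every operator has the default
        value 0.\<close>
      then have "heis_rep n h v = 0" for h :: "heis_index \<Rightarrow> 'a" by (simp add: heis_rep_def)
      moreover have "heis_rep n h 0 = 0" for h :: "heis_index \<Rightarrow> 'a"
        by (auto simp: heis_rep_def fun_eq_iff split: nat.split)
      ultimately show ?thesis by (simp add: commutator_def)
    qed
  qed
next
  show "inj_on (heis_rep n) (heis n :: (heis_index \<Rightarrow> 'a) set)"
  proof (rule inj_onI)
    fix f g :: "heis_index \<Rightarrow> 'a"
    assume fg: "f \<in> heis n" "g \<in> heis n" and eq: "heis_rep n f = heis_rep n g"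
    have mult_if: "c * (if P then 1 else 0) = (if P then c else 0)" for c :: 'a and P by simp
    \<comment> \<open>Matrix entries are recovered by evaluating at unit vectors.\<close>
    have X: "heis_rep n h (unit_vec (Suc i)) 0 = h (X i)"
      and Y: "heis_rep n h (unit_vec (Suc n)) (Suc i) = h (Y i)" if "i < n"
      for i and h :: "heis_index \<Rightarrow> 'a"
      using that by (simp_all add: heis_rep_def unit_vec_in_coord_space)
        (simp_all add: unit_vec_def mult_if)
    have Z: "heis_rep n h (unit_vec (Suc n)) 0 = h Z" for h :: "heis_index \<Rightarrow> 'a"
      by (simp add: heis_rep_def unit_vec_in_coord_space) (simp add: unit_vec_def mult_if)
    show "f = g"
    proof
      fix k
      show "f k = g k"
      proof (cases "k \<in> heis_indices n")
        case True
        then show ?thesis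
          using X[of _ f] X[of _ g] Y[of _ f] Y[of _ g] Z[of f] Z[of g] eq
          by (auto simp: heis_indices_def)
      qed (use fg in \<open>simp add: heis_def\<close>)
    qed
  qed
qed

text \<open>In characteristic \<open>2\<close> the commutator of \<open>E\<^sub>0\<^sub>1\<close> and \<open>E\<^sub>1\<^sub>0\<close> is the identity.\<close>

definition heis_rep2 :: "(heis_index \<Rightarrow> 'a::field) \<Rightarrow> (nat \<Rightarrow> 'a) \<Rightarrow> nat \<Rightarrow> 'a"
  where "heis_rep2 f v = (if v \<in> coord_space 2 then
    (\<lambda>k. if k = 0 then f (X 0) * v 1 + f Z * v 0
      else if k = 1 then f (Y 0) * v 0 + f Z * v 1 else 0)
    else 0)"

lemma heis_rep2_in_coord_space: "heis_rep2 f v \<in> coord_space 2"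
  by (auto simp: heis_rep2_def coord_space_def)

text \<open>The identity is central and linearly independent of the two off-diagonal matrix units,
  so the representation is faithful.\<close>

lemma heis_faithful_dim_char_2:
  assumes "(2 :: 'a::field) = 0"
  shows "2 \<in> faithful_dims (pointwise (*) :: 'a \<Rightarrow> (nat \<Rightarrow> 'a) \<Rightarrow> nat \<Rightarrow> 'a) 1"
proof (rule coord_space_faithful_dimsI[where \<rho> = heis_rep2])
  fix f g :: "heis_index \<Rightarrow> 'a" and c
  show "heis_rep2 f \<in> gl (pointwise (*)) (coord_space 2)"
    unfolding gl_def pointwise_def
  proof (intro CollectI conjI ballI allI impI Pi_I)
    fix u v :: "nat \<Rightarrow> 'a"
    assume uv: "u \<in> coord_space 2" "v \<in> coord_space 2"
    show "heis_rep2 f (u + v) = heis_rep2 f u + heis_rep2 f v"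
      using uv coord_space_closed(1)[OF uv]
      by (simp add: heis_rep2_def fun_eq_iff algebra_simps)
  next
    fix c and v :: "nat \<Rightarrow> 'a"
    assume v: "v \<in> coord_space 2"
    show "heis_rep2 f (\<lambda>i. c * v i) = (\<lambda>i. c * heis_rep2 f v i)"
      using v coord_space_closed(2)[OF v, of c]
      by (simp add: heis_rep2_def fun_eq_iff algebra_simps)
  qed (simp_all only: heis_rep2_in_coord_space, simp add: heis_rep2_def)
  show "heis_rep2 (f + g) = heis_rep2 f + heis_rep2 g"
    by (auto simp: heis_rep2_def fun_eq_iff algebra_simps)
  show "heis_rep2 (pointwise (*) c f) = pointwise (pointwise (*)) c (heis_rep2 f)"
    by (auto simp: heis_rep2_def fun_eq_iff pointwise_def algebra_simps)
  show "heis_rep2 (heis_br 1 f g) = commutator (heis_rep2 f) (heis_rep2 g)"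
  proof (intro ext)
    fix v :: "nat \<Rightarrow> 'a" and k
    show "heis_rep2 (heis_br 1 f g) v k = commutator (heis_rep2 f) (heis_rep2 g) v k"
    proof (cases "v \<in> coord_space 2")
      case True
      have action: "heis_rep2 f v k = (if k = 0 then f (X 0) * v 1 + f Z * v 0
          else if k = 1 then f (Y 0) * v 0 + f Z * v 1 else 0)"
        if "v \<in> coord_space 2" for f :: "heis_index \<Rightarrow> 'a" and v k
        using that by (simp add: heis_rep2_def)
      \<comment> \<open>In row 1 the commutator gives the negative of the bracket coefficient;
        \<open>2 = 0\<close> removes the sign.\<close>
      show ?thesis
        using assms
        by (simp add: commutator_def action[OF True] action[OF heis_rep2_in_coord_space] heis_br_def
            algebra_simps)
    next
      case False
      then have "heis_rep2 h v = 0" for h :: "heis_index \<Rightarrow> 'a" by (simp add: heis_rep2_def)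
      moreover have "heis_rep2 h 0 = 0" for h :: "heis_index \<Rightarrow> 'a"
        by (auto simp: heis_rep2_def fun_eq_iff split: nat.split)
      ultimately show ?thesis by (simp add: commutator_def)
    qed
  qed
next
  show "inj_on heis_rep2 (heis 1 :: (heis_index \<Rightarrow> 'a) set)"
  proof (rule inj_onI)
    fix f g :: "heis_index \<Rightarrow> 'a"
    assume fg: "f \<in> heis 1" "g \<in> heis 1" and eq: "heis_rep2 f = heis_rep2 g"
    have "heis_rep2 h (unit_vec 1) 0 = h (X 0)" "heis_rep2 h (unit_vec 0) 1 = h (Y 0)"
      "heis_rep2 h (unit_vec 0) 0 = h Z" for h :: "heis_index \<Rightarrow> 'a"
      by (simp_all add: heis_rep2_def unit_vec_in_coord_space) (simp_all add: unit_vec_def)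
    note * = this[of f] this[of g]
    show "f = g"
    proof
      fix k
      show "f k = g k"
        using * eq fg by (cases "k \<in> heis_indices 1") (auto simp: heis_indices_def heis_def)
    qed
  qed
qed

text \<open>\<open>LEAST\<close> is unspecified on an empty set, hence the second conjunct. The
  third extends minimality from modules of sequences to modules in any ambient vector space.\<close>

theorem theorem3p1:
  fixes n :: nat
  assumes "n \<ge> 1"
  shows "min_faithful_dim TYPE('a::field) n = (if n = 1 \<and> CHAR('a) = 2 then 2 else n + 2)
    \<and> min_faithful_dim TYPE('a) n
        \<in> faithful_dims (pointwise (*) :: 'a \<Rightarrow> (nat \<Rightarrow> 'a) \<Rightarrow> nat \<Rightarrow> 'a) n
    \<and> (\<forall>scale :: 'a \<Rightarrow> 'v::ab_group_add \<Rightarrow> 'v. \<forall>m \<in> faithful_dims scale n.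
          min_faithful_dim TYPE('a) n \<le> m)"
proof -
  have "(2 :: 'a) = 0 \<longleftrightarrow> CHAR('a) dvd 2"
    using of_nat_eq_0_iff_char_dvd[where 'a = 'a, of 2] by simp
  also have "\<dots> \<longleftrightarrow> CHAR('a) = 2"
    using prime_nat_iff[of 2] CHAR_not_1[where 'a = 'a] by auto
  finally have char: "(2 :: 'a) = 0 \<longleftrightarrow> CHAR('a) = 2" .
  let ?d = "if n = 1 \<and> CHAR('a) = 2 then 2 else n + 2"
  \<comment> \<open>The ambient type is kept general: the bound is used both for sequences and for
    the type of the last conjunct.\<close>
  have lower: "?d \<le> m" if m: "m \<in> faithful_dims scale n"
    for scale :: "'a \<Rightarrow> 'w::ab_group_add \<Rightarrow> 'w" and m
  proof -
    obtain V \<rho> where "m = vector_space.dim scale V"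
      "faithful_lie_module (pointwise (*)) (heis n) (heis_br n) scale V \<rho>"
      using m by (auto simp: faithful_dims_def)
    then show ?thesis using faithful_heis_module_dim[OF _ assms, of scale V \<rho>] char by auto
  qed
  have attained: "?d \<in> faithful_dims (pointwise (*) :: 'a \<Rightarrow> (nat \<Rightarrow> 'a) \<Rightarrow> nat \<Rightarrow> 'a) n"
    using heis_faithful_dim[of n] heis_faithful_dim_char_2 char by auto
  have min: "min_faithful_dim TYPE('a) n = ?d"
    unfolding min_faithful_dim_def using attained lower by (rule Least_equality)
  show ?thesis
    unfolding min by (intro conjI allI ballI refl attained lower)
qed

end
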